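(* Consider, for $(n,m)\in\{0,\dots,N-1\}\times\{1,\dots,M\}$, the system $$s_m^{n+1}=\bar\Delta\left(1+\frac{\varphi(c_{m+1}^n)-\varphi(c_{m-1}^n)}{4\varphi(c_m^n)}\right)s_{m+1}^n+\bar\Delta\left(1-\frac{\varphi(c_{m+1}^n)-\varphi(c_{m-1}^n)}{4\varphi(c_m^n)}\right)s_{m-1}^n+\left[1-2\bar\Delta-\lambda\Delta_tc_m^n(1-\varphi_2s_m^n)\right]s_m^n,$$ $$c_m^{n+1}=c_m^n\,e^{-\lambda\Delta_t\,s_m^n\,\varphi(c_m^n)},$$ with initial conditions $s_m^0=\bar s_0$, $c_m^0=\bar c_0$ for $m=1,\dots,M$, where $0\le\bar s_0\le\widetilde\eta$; right boundary convention $s_{M+1}^n=s_{M-1}^n$, $c_{M+1}^n=c_{M-1}^n$; and left boundary values $s_0^n=\widetilde\psi^n$, $c_0^n=\bar c_0\exp\left(-\lambda\int_0^{t_n}\Psi_u\,du\right)$. Suppose that $\bar\Delta\le1/2$ and that $$\bar c_0<\frac45\,\frac{\varphi_1}{|\varphi_2|},\qquad \Delta_t\le\frac{\Delta_x^2}{2+\lambda\bar c_0\Delta_x^2(1-\varphi_2\widetilde\eta)} .$$ Then, for any $(n,m)\in\{1,\dots,N\}\times\{1,\dots,M\}$ and any $\omega\in\Omega$, $$(s_m^n(\omega),c_m^n(\omega))\in[0,\widetilde\eta)\times[0,\bar c_0].$$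
   Context: Mesh: $T,\overline x>0$, $M,N\in\mathbb N$, $\Delta_x=\overline x/M$, $\Delta_t=T/N$, $\bar\Delta=\Delta_t/\Delta_x^2$, $t_n=n\Delta_t$. Parameters: $\alpha,\gamma,\sigma,\eta,\lambda,\bar c_0>0$, $\gamma<\eta$, $\min\left(\frac{2\alpha\gamma}{\sigma^2\eta},\frac{2\alpha(\eta-\gamma)}{\sigma^2\eta}\right)>1$; $\varphi(c)=\varphi_1+\varphi_2c$ with $\varphi_1>0$, $\varphi_2<0$; $\widetilde\eta=\eta/(\varphi_1+\bar c_0\varphi_2)$. Boundary data: $W$ is a Wiener process on the probability space $\Omega$ and $\Psi$ is the $[0,\eta]$-valued solution of $d\Psi_t=\alpha(\gamma-\Psi_t)dt+\sigma\sqrt{\Psi_t(\eta-\Psi_t)}\,dW_t$, $\Psi_0=\psi^0\in[0,\eta]$. Its discretization $\psi^n$ is given by $y^0=2\arcsin\sqrt{\psi^0/\eta}$ and, for $n=1,\dots,N$, $$y^n=y^{n-1}+f_{\Delta}(y^{n-1})\Delta_t+\sigma(W_{t_n}-W_{t_{n-1}}),\qquad \psi^n=\eta\sin^2(y^n/2),$$ so that $\psi^n\in[0,\eta]$, and $$\widetilde\psi^n=\frac{\psi^n}{\varphi\left(\bar c_0\exp\left(-\lambda\int_0^{t_n}\Psi_u\,du\right)\right)} .$$ Here $f(y)=a_1\cot(y/2)-a_2\tan(y/2)$, $a_1=\frac{4\alpha\gamma-\sigma^2\eta}{4\eta}$, $a_2=\frac{4\alpha(\eta-\gamma)-\sigma^2\eta}{4\eta}$,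 $C_0=(2\alpha-\sigma^2)/4$, $y^*=2\arctan\sqrt{a_1/a_2}$, $k\in(0,1)$ is fixed, $\Delta=\Delta_t<\Delta^*:=\left(\min\{y^*,\pi-y^*,1\}\right)^{1/k}$, and, with $\epsilon=\Delta^k$, - $f_\Delta(y)=f(\epsilon)-\frac12\epsilon f'(\epsilon)-C_0(y-\frac12\epsilon)$ for $y<0$; - $f_\Delta(y)=f(\epsilon)+f'(\epsilon)(y-\epsilon)+\frac{1}{2\epsilon}(f'(\epsilon)+C_0)(y-\epsilon)^2$ for $0\le y<\epsilon$; - $f_\Delta(y)=f(y)$ for $\epsilon\le y\le\pi-\epsilon$; - $f_\Delta(y)=f(\pi-\epsilon)+f'(\pi-\epsilon)(y-\pi+\epsilon)-\frac{1}{2\epsilon}(f'(\pi-\epsilon)+C_0)(y-\pi+\epsilon)^2$ for $\pi-\epsilon<y\le\pi$; - $f_\Delta(y)=f(\pi-\epsilon)+\frac12\epsilon f'(\pi-\epsilon)-C_0(y-\pi+\frac12\epsilon)$ for $y>\pi$. *)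

theory Defs
  imports "HOL-Probability.Probability"
begin

text \<open>Time is the half line \<open>t \<ge> 0\<close>; unlike in the locale \<open>filtration\<close>, whose index set is a whole
  type, no condition is put on \<open>F t\<close> for \<open>t < 0\<close>.\<close>

definition filtration_on :: "'a measure \<Rightarrow> (real \<Rightarrow> 'a measure) \<Rightarrow> bool" where
  "filtration_on P F \<longleftrightarrow>
     (\<forall>t\<ge>0. subalgebra P (F t)) \<and>
     (\<forall>s t. 0 \<le> s \<and> s \<le> t \<longrightarrow> sets (F s) \<subseteq> sets (F t))"

definition wiener_process ::
  "'a measure \<Rightarrow> (real \<Rightarrow> 'a measure) \<Rightarrow> (real \<Rightarrow> 'a \<Rightarrow> real) \<Rightarrow> bool" where
  "wiener_process P F W \<longleftrightarrow>
     prob_space P \<and> filtration_on P F \<and>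
     (\<forall>t\<ge>0. W t \<in> borel_measurable (F t)) \<and>
     (AE \<omega> in P. W 0 \<omega> = 0) \<and>
     (AE \<omega> in P. continuous_on {0..} (\<lambda>t. W t \<omega>)) \<and>
     (\<forall>s t. 0 \<le> s \<and> s < t \<longrightarrow>
        distributed P lborel (\<lambda>\<omega>. W t \<omega> - W s \<omega>) (\<lambda>x. ennreal (normal_density 0 (sqrt (t - s)) x)) \<and>
        prob_space.indep_set P (sets (F s))
          (sets (vimage_algebra (space P) (\<lambda>\<omega>. W t \<omega> - W s \<omega>) borel)))"

text \<open>The triple \<open>(k, \<tau>, \<xi>)\<close> encodes the simple process
  \<open>\<Sum>i<k. \<xi> i * 1_(\<tau> i, \<tau> (i+1)]\<close> on \<open>[0, t]\<close>.\<close>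

definition simple_process ::
  "'a measure \<Rightarrow> (real \<Rightarrow> 'a measure) \<Rightarrow> real \<Rightarrow> nat \<Rightarrow> (nat \<Rightarrow> real) \<Rightarrow> (nat \<Rightarrow> 'a \<Rightarrow> real) \<Rightarrow> bool" where
  "simple_process P F t k \<tau> \<xi> \<longleftrightarrow>
     0 \<le> \<tau> 0 \<and> \<tau> k \<le> t \<and> (\<forall>i<k. \<tau> i \<le> \<tau> (Suc i)) \<and>
     (\<forall>i<k. \<xi> i \<in> borel_measurable (F (\<tau> i)) \<and> (\<exists>B. \<forall>\<omega>\<in>space P. \<bar>\<xi> i \<omega>\<bar> \<le> B))"

definition simple_value ::
  "nat \<Rightarrow> (nat \<Rightarrow> real) \<Rightarrow> (nat \<Rightarrow> 'a \<Rightarrow> real) \<Rightarrow> real \<Rightarrow> 'a \<Rightarrow> real" where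
  "simple_value k \<tau> \<xi> u \<omega> = (\<Sum>i<k. \<xi> i \<omega> * indicator {\<tau> i<..\<tau> (Suc i)} u)"

definition simple_ito_integral ::
  "(real \<Rightarrow> 'a \<Rightarrow> real) \<Rightarrow> nat \<Rightarrow> (nat \<Rightarrow> real) \<Rightarrow> (nat \<Rightarrow> 'a \<Rightarrow> real) \<Rightarrow> 'a \<Rightarrow> real" where
  "simple_ito_integral W k \<tau> \<xi> \<omega> = (\<Sum>i<k. \<xi> i \<omega> * (W (\<tau> (Suc i)) \<omega> - W (\<tau> i) \<omega>))"

text \<open>\<open>I\<close> is a version of the Ito integral \<open>\<integral>\<^sub>0\<^sup>t H\<^sub>u dW\<^sub>u\<close>: the integrand is progressively measurable,
  and along some sequence of simple processes converging to \<open>H\<close> in \<open>L\<^sup>2([0,t] \<times> \<Omega>)\<close> the elementary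
  integrals converge to \<open>I\<close> in \<open>L\<^sup>2(\<Omega>)\<close>. By the Ito isometry, \<open>I\<close> is determined almost surely
  and does not depend on the sequence. The \<open>L\<^sup>2\<close> distances are nonnegative (possibly infinite)
  integrals, so no integrability side conditions are hidden.\<close>

definition is_ito_integral ::
  "'a measure \<Rightarrow> (real \<Rightarrow> 'a measure) \<Rightarrow> (real \<Rightarrow> 'a \<Rightarrow> real) \<Rightarrow> (real \<Rightarrow> 'a \<Rightarrow> real) \<Rightarrow> real \<Rightarrow> ('a \<Rightarrow> real) \<Rightarrow> bool"
  where
  "is_ito_integral P F W H t I \<longleftrightarrow>
     (\<forall>r\<in>{0..t}. (\<lambda>(u, \<omega>). H u \<omega>) \<in> borel_measurable (restrict_space borel {0..r} \<Otimes>\<^sub>M F r)) \<and>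
     I \<in> borel_measurable P \<and>
     (\<exists>k \<tau> \<xi>. (\<forall>j::nat. simple_process P F t (k j) (\<tau> j) (\<xi> j)) \<and>
        (\<lambda>j. \<integral>\<^sup>+\<omega>. (\<integral>\<^sup>+u. ennreal ((simple_value (k j) (\<tau> j) (\<xi> j) u \<omega> - H u \<omega>)\<^sup>2) * indicator {0..t} u
           \<partial>lborel) \<partial>P) \<longlonglongrightarrow> 0 \<and>
        (\<lambda>j. \<integral>\<^sup>+\<omega>. ennreal ((simple_ito_integral W (k j) (\<tau> j) (\<xi> j) \<omega> - I \<omega>)\<^sup>2) \<partial>P) \<longlonglongrightarrow> 0)"

text \<open>\<open>X\<close> is a continuous adapted solution on \<open>[0, T]\<close> of
  \<open>dX\<^sub>t = a(X\<^sub>t) dt + b(X\<^sub>t) dW\<^sub>t\<close>, \<open>X\<^sub>0 = x\<^sub>0\<close>, for square integrable \<open>b(X)\<close>. All paths, and not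
  only almost all, are required to be continuous, so that \<open>\<integral>\<^sub>0\<^sup>t X\<^sub>u du\<close> exists for each \<open>\<omega>\<close>.\<close>

definition sde_solution ::
  "'a measure \<Rightarrow> (real \<Rightarrow> 'a measure) \<Rightarrow> (real \<Rightarrow> 'a \<Rightarrow> real) \<Rightarrow> (real \<Rightarrow> real) \<Rightarrow> (real \<Rightarrow> real) \<Rightarrow>
    real \<Rightarrow> real \<Rightarrow> (real \<Rightarrow> 'a \<Rightarrow> real) \<Rightarrow> bool" where
  "sde_solution P F W a b x\<^sub>0 T X \<longleftrightarrow>
     (\<forall>t\<in>{0..T}. X t \<in> borel_measurable (F t)) \<and>
     (\<forall>\<omega>\<in>space P. continuous_on {0..T} (\<lambda>t. X t \<omega>) \<and> X 0 \<omega> = x\<^sub>0) \<and>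
     (\<forall>t\<in>{0..T}. \<exists>I. is_ito_integral P F W (\<lambda>u \<omega>. b (X u \<omega>)) t I \<and>
        (AE \<omega> in P. (\<lambda>u. a (X u \<omega>)) integrable_on {0..t} \<and>
           X t \<omega> = x\<^sub>0 + integral {0..t} (\<lambda>u. a (X u \<omega>)) + I \<omega>))"

text \<open>\<open>drift_f\<close> is the drift of the transformed process \<open>Y = 2 arcsin (sqrt (\<Psi> / \<eta>))\<close>, which has constant
  diffusion coefficient \<open>\<sigma>\<close>. It is singular at \<open>0\<close> and \<open>pi\<close>; \<open>drift_f_trunc\<close> replaces it
  outside \<open>[\<epsilon>, pi - \<epsilon>]\<close>, where \<open>\<epsilon> = \<Delta> powr k\<close>, by quadratic and then affine pieces.\<close>

definition drift_a1 :: "real \<Rightarrow> real \<Rightarrow> real \<Rightarrow> real \<Rightarrow> real" where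
  "drift_a1 \<alpha> \<gamma> \<sigma> \<eta> = (4 * \<alpha> * \<gamma> - \<sigma>\<^sup>2 * \<eta>) / (4 * \<eta>)"

definition drift_a2 :: "real \<Rightarrow> real \<Rightarrow> real \<Rightarrow> real \<Rightarrow> real" where
  "drift_a2 \<alpha> \<gamma> \<sigma> \<eta> = (4 * \<alpha> * (\<eta> - \<gamma>) - \<sigma>\<^sup>2 * \<eta>) / (4 * \<eta>)"

definition drift_C0 :: "real \<Rightarrow> real \<Rightarrow> real" where
  "drift_C0 \<alpha> \<sigma> = (2 * \<alpha> - \<sigma>\<^sup>2) / 4"

definition y_star :: "real \<Rightarrow> real \<Rightarrow> real \<Rightarrow> real \<Rightarrow> real" where
  "y_star \<alpha> \<gamma> \<sigma> \<eta> = 2 * arctan (sqrt (drift_a1 \<alpha> \<gamma> \<sigma> \<eta> / drift_a2 \<alpha> \<gamma> \<sigma> \<eta>))"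

definition drift_f :: "real \<Rightarrow> real \<Rightarrow> real \<Rightarrow> real \<Rightarrow> real \<Rightarrow> real" where
  "drift_f \<alpha> \<gamma> \<sigma> \<eta> y = drift_a1 \<alpha> \<gamma> \<sigma> \<eta> * cot (y / 2) - drift_a2 \<alpha> \<gamma> \<sigma> \<eta> * tan (y / 2)"

definition drift_f_trunc :: "real \<Rightarrow> real \<Rightarrow> real \<Rightarrow> real \<Rightarrow> real \<Rightarrow> real \<Rightarrow> real \<Rightarrow> real" where
  "drift_f_trunc \<alpha> \<gamma> \<sigma> \<eta> k \<Delta> y =
    (let \<epsilon> = \<Delta> powr k; f = drift_f \<alpha> \<gamma> \<sigma> \<eta>; f' = deriv f; C\<^sub>0 = drift_C0 \<alpha> \<sigma> in
     if y < 0 then f \<epsilon> - 1/2 * \<epsilon> * f' \<epsilon> - C\<^sub>0 * (y - 1/2 * \<epsilon>)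
     else if y < \<epsilon> then f \<epsilon> + f' \<epsilon> * (y - \<epsilon>) + 1 / (2 * \<epsilon>) * (f' \<epsilon> + C\<^sub>0) * (y - \<epsilon>)\<^sup>2
     else if y \<le> pi - \<epsilon> then f y
     else if y \<le> pi then
       f (pi - \<epsilon>) + f' (pi - \<epsilon>) * (y - pi + \<epsilon>)
         - 1 / (2 * \<epsilon>) * (f' (pi - \<epsilon>) + C\<^sub>0) * (y - pi + \<epsilon>)\<^sup>2
     else f (pi - \<epsilon>) + 1/2 * \<epsilon> * f' (pi - \<epsilon>) - C\<^sub>0 * (y - pi + 1/2 * \<epsilon>))"

end

theory Submission
  imports Defs
begin

text \<open>
  Discrete maximum principle. The bound on \<open>c0bar\<close> keeps \<open>\<phi>\<close> on \<open>(0, c0bar]\<close> above \<open>\<phi>1 / 5\<close>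
  and its oscillation below \<open>4 \<phi>1 / 5\<close>, so the weights of the two neighbours in the scheme are
  positive; the bound on \<open>\<Delta>t\<close> makes the weight of the central value nonnegative. The weights sum to
  \<open>1 - lam \<Delta>t c (1 - \<phi>2 s)\<close>, and it is the positive reaction term, together with
  \<open>2 \<Delta>bar < 1\<close> when the central value vanishes, that makes the upper bound strict.
\<close>

text \<open>The least value of \<open>p + q * z\<close> on \<open>{0<..C}\<close> is
  \<open>p + q * C\<close>, and two values there differ by less than \<open>- q * C\<close>, since
  the interval is open at 0. The constant 4/5 is exactly what makes
  \<open>- q * C < 4 * (p + q * C)\<close>.\<close>

lemma neighbour_weight_bound:
  fixes p q C c l r :: real
  assumes "q < 0" "C < 4 / 5 * (p / \<bar>q\<bar>)"
    and "c \<in> {0<..C}" "l \<in> {0<..C}" "r \<in> {0<..C}"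
  shows "\<bar>((p + q * r) - (p + q * l)) / (4 * (p + q * c))\<bar> < 1"
proof -
  have C: "- q * C < 4 / 5 * p"
    using assms(1,2) by (simp add: field_simps)
  have c: "- q * c \<le> - q * C"
    using assms by (intro mult_left_mono) auto
  have "\<bar>r - l\<bar> < C"
    using assms by auto
  then have "- q * \<bar>r - l\<bar> < - q * C"
    using assms by (intro mult_strict_left_mono) auto
  moreover have "\<bar>(p + q * r) - (p + q * l)\<bar> = - q * \<bar>r - l\<bar>"
    using assms(1) by (simp add: abs_mult flip: right_diff_distrib)
  moreover have "- q * C < 4 * (p + q * c)"
    using C c by (simp add: algebra_simps)
  ultimately have "\<bar>(p + q * r) - (p + q * l)\<bar> < 4 * (p + q * c)"
    by simp
  then show ?thesis
    by (simp add: abs_divide)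
qed

text \<open>All three weights are nonnegative, and without \<open>g\<close> they sum to 1, so the
  upper bound is an average of values at most \<open>H\<close> minus the loss \<open>g * s\<close>.
  Treating the reaction coefficient \<open>g\<close> as a number hides its dependence on
  \<open>s\<close>, which makes the scheme nonlinear.\<close>

lemma three_point_scheme_bounds:
  fixes D a b g H s l r :: real
  assumes "0 < D" "2 * D < 1" "\<bar>a\<bar> < 1" "0 < g" "g \<le> 1 - 2 * D"
    and "0 < H" "s \<in> {0..H}" "l \<in> {0..H}" "r \<in> {0..H}"
  shows "D * (1 + a) * r + D * (1 - a) * l + (1 - 2 * D - g) * s \<in> {0..<H}"
proof -
  have "D * (1 + a) * r \<le> D * (1 + a) * H" "D * (1 - a) * l \<le> D * (1 - a) * H"
    using assms by (auto intro!: mult_left_mono)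
  moreover have "D * (1 + a) * H + D * (1 - a) * H = 2 * D * H"
    by (simp add: algebra_simps)
  moreover have "(1 - 2 * D - g) * s < (1 - 2 * D) * H"
  proof (cases "s = 0")
    case True
    then show ?thesis using assms by simp
  next
    case False
    then have "(1 - 2 * D - g) * s < (1 - 2 * D) * s"
      using assms by simp
    also have "\<dots> \<le> (1 - 2 * D) * H"
      using assms by (intro mult_left_mono) auto
    finally show ?thesis .
  qed
  moreover have "2 * D * H + (1 - 2 * D) * H = H"
    by (simp add: algebra_simps)
  moreover have "0 \<le> D * (1 + a) * r" "0 \<le> D * (1 - a) * l" "0 \<le> (1 - 2 * D - g) * s"
    using assms by auto
  ultimately show ?thesis by auto
qed

theorem proposition4p3:
  fixes T xbar :: real and M N :: nat
    and \<Delta>x \<Delta>t \<Delta>bar :: real and t :: "nat \<Rightarrow> real"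
    and \<alpha> \<gamma> \<sigma> \<eta> lam c0bar s0bar \<phi>1 \<phi>2 \<eta>tilde k \<psi>0 :: real
    and \<phi> :: "real \<Rightarrow> real"
    and P :: "'a measure" and F :: "real \<Rightarrow> 'a measure"
    and W \<Psi> :: "real \<Rightarrow> 'a \<Rightarrow> real"
    and y \<psi> \<psi>tilde :: "nat \<Rightarrow> 'a \<Rightarrow> real"
    and s c :: "nat \<Rightarrow> nat \<Rightarrow> 'a \<Rightarrow> real"
  assumes mesh: "T > 0" "xbar > 0" "M \<ge> 1" "N \<ge> 1"
      "\<Delta>x = xbar / real M" "\<Delta>t = T / real N" "\<Delta>bar = \<Delta>t / \<Delta>x\<^sup>2"
      "\<And>n. t n = real n * \<Delta>t"
    and params: "\<alpha> > 0" "\<gamma> > 0" "\<sigma> > 0" "\<eta> > 0" "lam > 0" "c0bar > 0" "\<gamma> < \<eta>"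
      "min (2 * \<alpha> * \<gamma> / (\<sigma>\<^sup>2 * \<eta>)) (2 * \<alpha> * (\<eta> - \<gamma>) / (\<sigma>\<^sup>2 * \<eta>)) > 1"
    and phi: "\<And>z. \<phi> z = \<phi>1 + \<phi>2 * z" "\<phi>1 > 0" "\<phi>2 < 0"
    and eta_tilde: "\<eta>tilde = \<eta> / (\<phi>1 + c0bar * \<phi>2)"
    and trunc: "0 < k" "k < 1"
      "\<Delta>t < (min (y_star \<alpha> \<gamma> \<sigma> \<eta>) (min (pi - y_star \<alpha> \<gamma> \<sigma> \<eta>) 1)) powr (1 / k)"
    and wiener: "wiener_process P F W"
    and Psi_init: "\<psi>0 \<in> {0..\<eta>}"
    and Psi_sde: "sde_solution P F W (\<lambda>x. \<alpha> * (\<gamma> - x)) (\<lambda>x. \<sigma> * sqrt (x * (\<eta> - x))) \<psi>0 T \<Psi>"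
    and Psi_range: "\<And>u \<omega>. u \<in> {0..T} \<Longrightarrow> \<omega> \<in> space P \<Longrightarrow> \<Psi> u \<omega> \<in> {0..\<eta>}"
    and y_init: "\<And>\<omega>. \<omega> \<in> space P \<Longrightarrow> y 0 \<omega> = 2 * arcsin (sqrt (\<psi>0 / \<eta>))"
    and y_step: "\<And>n \<omega>. n \<in> {1..N} \<Longrightarrow> \<omega> \<in> space P \<Longrightarrow>
        y n \<omega> = y (n - 1) \<omega> + drift_f_trunc \<alpha> \<gamma> \<sigma> \<eta> k \<Delta>t (y (n - 1) \<omega>) * \<Delta>t
          + \<sigma> * (W (t n) \<omega> - W (t (n - 1)) \<omega>)"
    and psi_init: "\<And>\<omega>. \<omega> \<in> space P \<Longrightarrow> \<psi> 0 \<omega> = \<psi>0"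
    and psi_step: "\<And>n \<omega>. n \<in> {1..N} \<Longrightarrow> \<omega> \<in> space P \<Longrightarrow> \<psi> n \<omega> = \<eta> * (sin (y n \<omega> / 2))\<^sup>2"
    and psi_tilde: "\<And>n \<omega>. n \<le> N \<Longrightarrow> \<omega> \<in> space P \<Longrightarrow>
        \<psi>tilde n \<omega> = \<psi> n \<omega> / \<phi> (c0bar * exp (- lam * integral {0..t n} (\<lambda>u. \<Psi> u \<omega>)))"
    and s_step: "\<And>n m \<omega>. n \<in> {0..N-1} \<Longrightarrow> m \<in> {1..M} \<Longrightarrow> \<omega> \<in> space P \<Longrightarrow>
        s (n+1) m \<omega> =
          \<Delta>bar * (1 + (\<phi> (c n (m+1) \<omega>) - \<phi> (c n (m-1) \<omega>)) / (4 * \<phi> (c n m \<omega>))) * s n (m+1) \<omega>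
          + \<Delta>bar * (1 - (\<phi> (c n (m+1) \<omega>) - \<phi> (c n (m-1) \<omega>)) / (4 * \<phi> (c n m \<omega>))) * s n (m-1) \<omega>
          + (1 - 2 * \<Delta>bar - lam * \<Delta>t * c n m \<omega> * (1 - \<phi>2 * s n m \<omega>)) * s n m \<omega>"
    and c_step: "\<And>n m \<omega>. n \<in> {0..N-1} \<Longrightarrow> m \<in> {1..M} \<Longrightarrow> \<omega> \<in> space P \<Longrightarrow>
        c (n+1) m \<omega> = c n m \<omega> * exp (- lam * \<Delta>t * s n m \<omega> * \<phi> (c n m \<omega>))"
    and init: "\<And>m \<omega>. m \<in> {1..M} \<Longrightarrow> \<omega> \<in> space P \<Longrightarrow> s 0 m \<omega> = s0bar"
      "\<And>m \<omega>. m \<in> {1..M} \<Longrightarrow> \<omega> \<in> space P \<Longrightarrow> c 0 m \<omega> = c0bar"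
      "0 \<le> s0bar" "s0bar \<le> \<eta>tilde"
    and right_boundary:
      "\<And>n \<omega>. n \<le> N \<Longrightarrow> \<omega> \<in> space P \<Longrightarrow> s n (M+1) \<omega> = s n (M-1) \<omega>"
      "\<And>n \<omega>. n \<le> N \<Longrightarrow> \<omega> \<in> space P \<Longrightarrow> c n (M+1) \<omega> = c n (M-1) \<omega>"
    and left_boundary:
      "\<And>n \<omega>. n \<le> N \<Longrightarrow> \<omega> \<in> space P \<Longrightarrow> s n 0 \<omega> = \<psi>tilde n \<omega>"
      "\<And>n \<omega>. n \<le> N \<Longrightarrow> \<omega> \<in> space P \<Longrightarrow>
        c n 0 \<omega> = c0bar * exp (- lam * integral {0..t n} (\<lambda>u. \<Psi> u \<omega>))"
    and stability: "\<Delta>bar \<le> 1 / 2" "c0bar < 4 / 5 * (\<phi>1 / \<bar>\<phi>2\<bar>)"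
      "\<Delta>t \<le> \<Delta>x\<^sup>2 / (2 + lam * c0bar * \<Delta>x\<^sup>2 * (1 - \<phi>2 * \<eta>tilde))"
  shows "\<forall>n\<in>{1..N}. \<forall>m\<in>{1..M}. \<forall>\<omega>\<in>space P.
    (s n m \<omega>, c n m \<omega>) \<in> {0..<\<eta>tilde} \<times> {0..c0bar}"
proof -
  have \<Delta>t: "\<Delta>t > 0" and \<Delta>x: "\<Delta>x > 0" and \<Delta>bar: "\<Delta>bar > 0"
    using mesh by simp_all
  have \<phi>pos: "\<phi> c0bar > 0"
    using stability(2) phi by (simp add: field_simps)
  \<comment> \<open>\<open>\<phi>\<close> is decreasing, so \<open>\<phi> c0bar\<close> is its
    minimum over admissible concentrations and \<open>\<eta>tilde\<close> bounds every quotient of a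
    value in \<open>{0..\<eta>}\<close> by such a \<open>\<phi> z\<close>.\<close>
  have \<phi>ge: "\<phi> c0bar \<le> \<phi> z" if "z \<le> c0bar" for z
    using that phi by simp
  have \<eta>tilde: "\<eta>tilde > 0" "\<eta>tilde = \<eta> / \<phi> c0bar"
    using eta_tilde \<phi>pos params(4) phi(1) by (simp_all add: mult.commute)
  \<comment> \<open>The bound on \<open>\<Delta>t\<close>, cleared of its denominator and divided by
    \<open>\<Delta>x\<^sup>2\<close>: the central weight is nonnegative in the worst case
    \<open>c = c0bar\<close>, \<open>s = \<eta>tilde\<close>.\<close>
  have cfl: "2 * \<Delta>bar + lam * \<Delta>t * c0bar * (1 - \<phi>2 * \<eta>tilde) \<le> 1"
  proof -
    have pos: "0 < 1 - \<phi>2 * \<eta>tilde"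
      using phi(3) \<eta>tilde(1) by (smt (verit) mult_neg_pos)
    have "0 < 2 + lam * c0bar * \<Delta>x\<^sup>2 * (1 - \<phi>2 * \<eta>tilde)"
      using pos params \<Delta>x by (intro add_pos_pos mult_pos_pos) auto
    then have "\<Delta>t * (2 + lam * c0bar * \<Delta>x\<^sup>2 * (1 - \<phi>2 * \<eta>tilde)) \<le> \<Delta>x\<^sup>2"
      using stability(3) by (simp add: pos_le_divide_eq)
    then have "\<Delta>t * (2 + lam * c0bar * \<Delta>x\<^sup>2 * (1 - \<phi>2 * \<eta>tilde)) / \<Delta>x\<^sup>2 \<le> 1"
      using \<Delta>x by simp
    moreover have "\<Delta>t * (2 + lam * c0bar * \<Delta>x\<^sup>2 * (1 - \<phi>2 * \<eta>tilde)) / \<Delta>x\<^sup>2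
        = 2 * \<Delta>bar + lam * \<Delta>t * c0bar * (1 - \<phi>2 * \<eta>tilde)"
      unfolding mesh(7) using \<Delta>x by (simp add: field_simps)
    ultimately show ?thesis by simp
  qed

  have left: "s n 0 \<omega> \<in> {0..\<eta>tilde} \<and> c n 0 \<omega> \<in> {0<..c0bar}"
    if n: "n \<le> N" and \<omega>: "\<omega> \<in> space P" for n \<omega>
  proof -
    have "real n * \<Delta>t \<le> real N * \<Delta>t"
      using n \<Delta>t by (intro mult_right_mono) auto
    then have tn: "t n \<le> T"
      using mesh by simp
    \<comment> \<open>\<open>integral\<close> takes the default value 0 on a function that is not
      integrable, so the sign is right in both cases.\<close>
    have "0 \<le> integral {0..t n} (\<lambda>u. \<Psi> u \<omega>)"
    proof (cases "(\<lambda>u. \<Psi> u \<omega>) integrable_on {0..t n}")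
      case True
      then show ?thesis
        using Psi_range \<omega> tn by (intro integral_nonneg) auto
    qed (simp add: not_integrable_integral)
    then have c: "c n 0 \<omega> \<in> {0<..c0bar}"
      using left_boundary(2)[OF n \<omega>] params by simp
    \<comment> \<open>The value at time 0 is prescribed; afterwards the squared sine confines
      \<open>\<psi>\<close> for every \<open>y\<close>, hence on every path and not only almost
      surely.\<close>
    have \<psi>: "\<psi> n \<omega> \<in> {0..\<eta>}"
    proof (cases "n = 0")
      case True
      then show ?thesis using psi_init \<omega> Psi_init by simp
    next
      case False
      have "(sin (y n \<omega> / 2))\<^sup>2 \<le> 1"
        by (simp add: abs_square_le_1)
      then show ?thesis
        using False psi_step[of n \<omega>] n \<omega> params(4) by simp
    qed
    have "s n 0 \<omega> = \<psi> n \<omega> / \<phi> (c n 0 \<omega>)"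
      using left_boundary[OF n \<omega>] psi_tilde[OF n \<omega>] by simp
    moreover have "\<psi> n \<omega> / \<phi> (c n 0 \<omega>) \<le> \<eta> / \<phi> c0bar"
      using \<psi> \<phi>ge[of "c n 0 \<omega>"] c \<phi>pos by (intro frac_le) auto
    moreover have "0 \<le> \<psi> n \<omega> / \<phi> (c n 0 \<omega>)"
      using \<psi> \<phi>ge[of "c n 0 \<omega>"] c \<phi>pos by auto
    ultimately show ?thesis using c \<eta>tilde(2) by simp
  qed

  have extend: "s n m \<omega> \<in> {0..\<eta>tilde} \<and> c n m \<omega> \<in> {0<..c0bar}"
    if n: "n \<le> N" and \<omega>: "\<omega> \<in> space P" and m: "m \<le> M + 1"
      and interior: "\<And>j. j \<in> {1..M} \<Longrightarrow> s n j \<omega> \<in> {0..\<eta>tilde} \<and> c n j \<omega> \<in> {0<..c0bar}"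
    for n m \<omega>
  proof -
    \<comment> \<open>The node 0 is included because the reflected node \<open>M - 1\<close> is the
      left boundary when \<open>M = 1\<close>.\<close>
    have *: "s n j \<omega> \<in> {0..\<eta>tilde} \<and> c n j \<omega> \<in> {0<..c0bar}" if "j \<le> M" for j
      using left[OF n \<omega>] interior[of j] that by (cases "j = 0") auto
    show ?thesis
    proof (cases "m = M + 1")
      case True
      then show ?thesis
        using right_boundary[OF n \<omega>] *[of "M - 1"] by simp
    next
      case False
      then show ?thesis using *[of m] m by simp
    qed
  qed

  \<comment> \<open>Closed bounds on \<open>s\<close> at one time level give strict ones at the
    next. Carrying \<open>c > 0\<close>, more than the theorem claims, keeps the reaction term
    positive and supplies the open end at 0 for \<open>neighbour_weight_bound\<close>.\<close>
  have step: "s (Suc n) m \<omega> \<in> {0..<\<eta>tilde} \<and> c (Suc n) m \<omega> \<in> {0<..c0bar}"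
    if n: "n < N" and \<omega>: "\<omega> \<in> space P" and m: "m \<in> {1..M}"
      and interior: "\<And>j. j \<in> {1..M} \<Longrightarrow> s n j \<omega> \<in> {0..\<eta>tilde} \<and> c n j \<omega> \<in> {0<..c0bar}"
    for n m \<omega>
  proof -
    note ext = extend[OF less_imp_le[OF n] \<omega> _ interior]
    have here: "s n m \<omega> \<in> {0..\<eta>tilde}" "c n m \<omega> \<in> {0<..c0bar}"
      and right: "s n (m+1) \<omega> \<in> {0..\<eta>tilde}" "c n (m+1) \<omega> \<in> {0<..c0bar}"
      and lft: "s n (m-1) \<omega> \<in> {0..\<eta>tilde}" "c n (m-1) \<omega> \<in> {0<..c0bar}"
      using ext[of m] ext[of "m+1"] ext[of "m-1"] m by auto
    have n': "n \<in> {0..N-1}" using n by auto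
    define g where "g = lam * \<Delta>t * c n m \<omega> * (1 - \<phi>2 * s n m \<omega>)"
    have pos: "0 < 1 - \<phi>2 * s n m \<omega>"
      using phi(3) here(1) by (smt (verit) atLeastAtMost_iff mult_nonpos_nonneg)
    then have g_pos: "0 < g"
      unfolding g_def using here params \<Delta>t by (intro mult_pos_pos) auto
    \<comment> \<open>The coefficient grows with \<open>c\<close> and, since
      \<open>\<phi>2 < 0\<close>, also with \<open>s\<close>; the extreme values are those of
      \<open>cfl\<close>.\<close>
    have "g \<le> lam * \<Delta>t * c0bar * (1 - \<phi>2 * \<eta>tilde)"
      unfolding g_def using here params \<Delta>t phi(3) pos by (intro mult_mono) auto
    then have g_le: "g \<le> 1 - 2 * \<Delta>bar" using cfl by linarith
    have weight: "\<bar>(\<phi> (c n (m+1) \<omega>) - \<phi> (c n (m-1) \<omega>)) / (4 * \<phi> (c n m \<omega>))\<bar> < 1"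
      unfolding phi(1)
      by (rule neighbour_weight_bound[OF phi(3) stability(2) here(2) lft(2) right(2)])
    \<comment> \<open>The open premise \<open>2 * \<Delta>bar < 1\<close> follows from
      \<open>0 < g\<close> and \<open>g \<le> 1 - 2 * \<Delta>bar\<close>.\<close>
    have "s (Suc n) m \<omega> \<in> {0..<\<eta>tilde}"
      using three_point_scheme_bounds[OF \<Delta>bar _ weight g_pos g_le \<eta>tilde(1) here(1) lft(1) right(1)]
        g_pos g_le s_step[OF n' m \<omega>] unfolding g_def by simp
    moreover have "c (Suc n) m \<omega> \<in> {0<..c0bar}"
    proof -
      have "0 \<le> lam * \<Delta>t * s n m \<omega> * \<phi> (c n m \<omega>)"
        using here params \<Delta>t \<phi>ge[of "c n m \<omega>"] \<phi>pos by simp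
      then have "c n m \<omega> * exp (- lam * \<Delta>t * s n m \<omega> * \<phi> (c n m \<omega>)) \<le> c n m \<omega> * 1"
        using here by (intro mult_left_mono) auto
      then have "c (Suc n) m \<omega> \<le> c n m \<omega>"
        using c_step[OF n' m \<omega>] by simp
      moreover have "0 < c (Suc n) m \<omega>"
        using c_step[OF n' m \<omega>] here by simp
      ultimately show ?thesis
        using here by auto
    qed
    ultimately show ?thesis ..
  qed

  \<comment> \<open>The induction carries the closed interval for \<open>s\<close>, because
    \<open>s0bar = \<eta>tilde\<close> is allowed at level 0.\<close>
  have all: "s n m \<omega> \<in> {0..\<eta>tilde} \<and> c n m \<omega> \<in> {0<..c0bar}"
    if "n \<le> N" "m \<in> {1..M}" "\<omega> \<in> space P" for n m \<omega>
    using that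
  proof (induction n arbitrary: m)
    case 0
    then show ?case using init params(6) by simp
  next
    case (Suc n)
    then show ?case using step[of n \<omega> m] by fastforce
  qed

  show ?thesis
  proof (intro ballI)
    fix n m \<omega>
    assume "n \<in> {1..N}" and m: "m \<in> {1..M}" and \<omega>: "\<omega> \<in> space P"
    \<comment> \<open>For \<open>n \<ge> 1\<close>, one more application of \<open>step\<close> to
      the closed bounds at level \<open>n'\<close> gives the strict upper bound.\<close>
    then obtain n' where n': "n = Suc n'" "n' < N"
      by (cases n) auto
    then have "s n m \<omega> \<in> {0..<\<eta>tilde} \<and> c n m \<omega> \<in> {0<..c0bar}"
      using step[OF n'(2) \<omega> m] all[OF less_imp_le[OF n'(2)] _ \<omega>] by simp
    then show "(s n m \<omega>, c n m \<omega>) \<in> {0..<\<eta>tilde} \<times> {0..c0bar}"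
      by simp
  qed
qed

end
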